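(* Let $V$ be a countable set of propositional variables, let $\mathcal{T}$ be a countable propositional $\sigma$-coherent theory over $V$, and let $\varphi,\psi$ be propositional $\sigma$-coherent formulas over $V$. Then $\varphi\vdash\psi$ is derivable from $\mathcal{T}$ (written $\varphi\vdash^{\mathcal{T}}\psi$) if and only if $[\![\varphi]\!]^{\mathcal{T}}\subseteq[\![\psi]\!]^{\mathcal{T}}$.
   Context: Propositional $\sigma$-coherent formulas over $V$ are defined inductively: $\bot$, $\top$ and each $p\in V$ are formulas; if $\varphi,\psi$ are formulas so is $\varphi\wedge\psi$; if $\varphi_i$ is a formula for each $i\in\mathbb{N}$ then $\bigvee_{i\in\mathbb{N}}\varphi_i$ is a formula. A sequent is an expression $\varphi\vdash\psi$ with $\varphi,\psi$ formulas. The inference rules are: - $\varphi\vdash\varphi$; from $\varphi\vdash\psi$ and $\psi\vdash\chi$ infer $\varphi\vdash\chi$ (cut); - $\varphi\wedge\bigvee_{i\in\mathbb{N}}\psi_i\vdash\bigvee_{i\in\mathbb{N}}(\varphi\wedge\psi_i)$; - $\varphi\vdash\top$; $\varphi\wedge\psi\vdash\varphi$; $\varphi\wedge\psi\vdash\psi$; from $\chi\vdash\varphi$ and $\chi\vdash\psi$ infer $\chi\vdash\varphi\wedge\psi$; - $\bot\vdash\psi$; $\varphi_j\vdash\bigvee_{i\in\mathbb{N}}\varphi_i$ for each $j\in\mathbb{N}$; from $\varphi_i\vdash\psi$ for all $i\in\mathbb{N}$ infer $\bigvee_{i\in\mathbb{N}}\varphi_i\vdash\psi$ (so derivations are well-founded,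 possibly infinitely branching trees). A countable propositional $\sigma$-coherent theory over $V$ is a countable set $\mathcal{T}$ of sequents (called axioms) between formulas over $V$; a sequent is derivable from $\mathcal{T}$ if it has a derivation from the inference rules and the axioms in $\mathcal{T}$. Let $\mathbb{S}=\{\bot,\top\}$ and let $\mathbb{S}^V$ be the set of all functions $M\colon V\to\mathbb{S}$. Satisfaction: $M\vDash\bot$ never; $M\vDash\top$ always; $M\vDash p$ iff $M(p)=\top$; $M\vDash\varphi\wedge\psi$ iff $M\vDash\varphi$ and $M\vDash\psi$; $M\vDash\bigvee_{i}\varphi_i$ iff $M\vDash\varphi_i$ for some $i$. The space of $\mathcal{T}$-models is $X_{\mathcal{T}}=\{M\in\mathbb{S}^V\mid$ for every axiom $\sigma\vdash\theta$ of $\mathcal{T}$, $M\vDash\sigma$ implies $M\vDash\theta\}$, and $[\![\varphi]\!]^{\mathcal{T}}=\{M\in X_{\mathcal{T}}\mid M\vDash\varphi\}$. *)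

theory Defs
  imports "HOL-Library.Countable_Set" "HOL-Library.FuncSet"
begin

text \<open>
  Raw formulas take their variables from a whole type; the inductive set \<open>formulas V\<close> below
  singles out those over a set \<open>V\<close> of variables, which may be empty.
\<close>

datatype 'v form =
    Bot
  | Top
  | Var 'v
  | Conj "'v form" "'v form"
  | Disj "nat \<Rightarrow> 'v form"

inductive_set formulas :: "'v set \<Rightarrow> 'v form set" for V :: "'v set" where
  Bot: "Bot \<in> formulas V"
| Top: "Top \<in> formulas V"
| Var: "p \<in> V \<Longrightarrow> Var p \<in> formulas V"
| Conj: "\<phi> \<in> formulas V \<Longrightarrow> \<psi> \<in> formulas V \<Longrightarrow> Conj \<phi> \<psi> \<in> formulas V"
| Disj: "(\<And>i. \<phi> i \<in> formulas V) \<Longrightarrow> Disj \<phi> \<in> formulas V"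

text \<open>The pair \<open>(\<phi>, \<psi>)\<close> is the sequent with antecedent \<open>\<phi>\<close> and succedent \<open>\<psi>\<close>.\<close>

type_synonym 'v sequent = "'v form \<times> 'v form"

definition sequents :: "'v set \<Rightarrow> 'v sequent set" where
  "sequents V = formulas V \<times> formulas V"

definition countable_theory :: "'v set \<Rightarrow> 'v sequent set \<Rightarrow> bool" where
  "countable_theory V T \<longleftrightarrow> countable T \<and> T \<subseteq> sequents V"

text \<open>
  The membership premises keep every formula of a derivation, cut formulas included, over \<open>V\<close>
  (given that the axioms are).
\<close>

inductive derivable :: "'v set \<Rightarrow> 'v sequent set \<Rightarrow> 'v form \<Rightarrow> 'v form \<Rightarrow> bool"
  for V :: "'v set" and T :: "'v sequent set" where
  axiom: "(\<sigma>, \<theta>) \<in> T \<Longrightarrow> derivable V T \<sigma> \<theta>"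
| refl: "\<phi> \<in> formulas V \<Longrightarrow> derivable V T \<phi> \<phi>"
| cut: "derivable V T \<phi> \<psi> \<Longrightarrow> derivable V T \<psi> \<chi> \<Longrightarrow> derivable V T \<phi> \<chi>"
| distrib: "\<phi> \<in> formulas V \<Longrightarrow> (\<And>i. \<psi> i \<in> formulas V) \<Longrightarrow>
    derivable V T (Conj \<phi> (Disj \<psi>)) (Disj (\<lambda>i. Conj \<phi> (\<psi> i)))"
| top: "\<phi> \<in> formulas V \<Longrightarrow> derivable V T \<phi> Top"
| conj_left1: "\<phi> \<in> formulas V \<Longrightarrow> \<psi> \<in> formulas V \<Longrightarrow> derivable V T (Conj \<phi> \<psi>) \<phi>"
| conj_left2: "\<phi> \<in> formulas V \<Longrightarrow> \<psi> \<in> formulas V \<Longrightarrow> derivable V T (Conj \<phi> \<psi>) \<psi>"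
| conj_right: "derivable V T \<chi> \<phi> \<Longrightarrow> derivable V T \<chi> \<psi> \<Longrightarrow> derivable V T \<chi> (Conj \<phi> \<psi>)"
| bot: "\<psi> \<in> formulas V \<Longrightarrow> derivable V T Bot \<psi>"
| disj_right: "(\<And>i. \<phi> i \<in> formulas V) \<Longrightarrow> derivable V T (\<phi> j) (Disj \<phi>)"
| disj_left: "(\<And>i. derivable V T (\<phi> i) \<psi>) \<Longrightarrow> derivable V T (Disj \<phi>) \<psi>"

primrec satisfies :: "('v \<Rightarrow> bool) \<Rightarrow> 'v form \<Rightarrow> bool"  (infix "\<Turnstile>" 50) where
  "M \<Turnstile> Bot \<longleftrightarrow> False"
| "M \<Turnstile> Top \<longleftrightarrow> True"
| "M \<Turnstile> Var p \<longleftrightarrow> M p"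
| "M \<Turnstile> Conj \<phi> \<psi> \<longleftrightarrow> M \<Turnstile> \<phi> \<and> M \<Turnstile> \<psi>"
| "M \<Turnstile> Disj \<phi> \<longleftrightarrow> (\<exists>i. M \<Turnstile> \<phi> i)"

text \<open>
  The two-element set of truth values is \<open>bool\<close>. Functions with domain \<open>V\<close> are represented by
  extensional functions, so that each of them has exactly one representative.
\<close>

definition models :: "'v set \<Rightarrow> 'v sequent set \<Rightarrow> ('v \<Rightarrow> bool) set" where
  "models V T = {M \<in> V \<rightarrow>\<^sub>E (UNIV :: bool set). \<forall>(\<sigma>, \<theta>) \<in> T. M \<Turnstile> \<sigma> \<longrightarrow> M \<Turnstile> \<theta>}"

definition extent :: "'v set \<Rightarrow> 'v sequent set \<Rightarrow> 'v form \<Rightarrow> ('v \<Rightarrow> bool) set" where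
  "extent V T \<phi> = {M \<in> models V T. M \<Turnstile> \<phi>}"

end

theory Submission imports Defs begin

text \<open>
  Soundness is an induction on derivations. For completeness, suppose that \<open>\<psi>\<close> is not derivable from
  \<open>\<phi>\<close>. A model of \<open>\<phi>\<close> that refutes \<open>\<psi>\<close> is read off from a filter \<open>F\<close> of formulas, closed under
  derivability, that contains \<open>\<phi>\<close> and omits \<open>\<psi>\<close>: a variable is declared true iff it belongs to \<open>F\<close>.
  Truth and membership in \<open>F\<close> then agree on a formula as soon as \<open>F\<close> is prime for the
  disjunctions among its subformulas (\<open>satisfies_iff_mem\<close>), and closure under derivability makes all
  axioms hold.

  A formula is countable in size, and so is the theory, hence only countably many disjunctions
  matter, namely those occurring in \<open>\<phi>\<close>, \<open>\<psi>\<close> and the axioms. This is why a construction in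
  \<open>\<omega>\<close> steps produces \<open>F\<close>, as in the Rasiowa--Sikorski lemma
  (\<open>prime_filter_exists\<close>): starting from \<open>\<phi>\<close>, strengthen the current formula step by step,
  never making \<open>\<psi>\<close> derivable, and at step \<open>n\<close> settle the \<open>n\<close>th disjunction. The
  distributive law guarantees that every step is possible (\<open>settle_formula\<close>). The filter consists of
  the consequences of the formulas so obtained.
\<close>

lemma derivable_sound:
  assumes "derivable V T \<phi> \<psi>" and "M \<in> models V T" and "M \<Turnstile> \<phi>"
  shows "M \<Turnstile> \<psi>"
  using assms by (induction rule: derivable.induct) (auto simp: models_def)

primrec subformulas :: "'v form \<Rightarrow> 'v form set" where
  "subformulas Bot = {Bot}"
| "subformulas Top = {Top}"
| "subformulas (Var p) = {Var p}"
| "subformulas (Conj \<phi> \<psi>) = insert (Conj \<phi> \<psi>) (subformulas \<phi> \<union> subformulas \<psi>)"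
| "subformulas (Disj \<phi>) = insert (Disj \<phi>) (\<Union>i. subformulas (\<phi> i))"

lemma countable_subformulas: "countable (subformulas \<phi>)"
  by (induction \<phi>) auto

text \<open>
  Primeness is relative to a set \<open>K\<close>: over a consistent but uncountable theory, a filter that is
  prime for all disjunctions need not exist.
\<close>

definition prime_filter :: "'v set \<Rightarrow> 'v sequent set \<Rightarrow> 'v form set \<Rightarrow> 'v form set \<Rightarrow> bool" where
  "prime_filter V T K F \<longleftrightarrow>
     Top \<in> F \<and> Bot \<notin> F \<and>
     (\<forall>\<phi> \<psi>. \<phi> \<in> F \<longrightarrow> derivable V T \<phi> \<psi> \<longrightarrow> \<psi> \<in> F) \<and>
     (\<forall>\<phi> \<psi>. \<phi> \<in> F \<longrightarrow> \<psi> \<in> F \<longrightarrow> Conj \<phi> \<psi> \<in> F) \<and>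
     (\<forall>\<phi>. Disj \<phi> \<in> K \<longrightarrow> Disj \<phi> \<in> F \<longrightarrow> (\<exists>i. \<phi> i \<in> F))"

lemma satisfies_iff_mem:
  assumes F: "prime_filter V T K F"
    and "\<theta> \<in> formulas V" and "subformulas \<theta> \<subseteq> K"
  shows "restrict (\<lambda>p. Var p \<in> F) V \<Turnstile> \<theta> \<longleftrightarrow> \<theta> \<in> F"
  using assms(2,3)
proof (induction rule: formulas.induct)
  case (Conj \<phi> \<psi>)
  have "Conj \<phi> \<psi> \<in> F \<longleftrightarrow> \<phi> \<in> F \<and> \<psi> \<in> F"
    using F Conj.hyps unfolding prime_filter_def
    by (meson derivable.conj_left1 derivable.conj_left2)
  then show ?case
    using Conj by auto
next
  case (Disj \<phi>)
  have "\<exists>i. \<phi> i \<in> F" if "Disj \<phi> \<in> F"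
    using F that Disj.prems unfolding prime_filter_def by auto
  moreover have "Disj \<phi> \<in> F" if "\<phi> i \<in> F" for i
    using F that Disj.hyps derivable.disj_right[of \<phi> V T i] unfolding prime_filter_def by blast
  moreover have "restrict (\<lambda>p. Var p \<in> F) V \<Turnstile> \<phi> i \<longleftrightarrow> \<phi> i \<in> F" for i
    using Disj.prems by (intro Disj.IH) auto
  ultimately show ?case
    unfolding satisfies.simps by blast
qed (use F in \<open>auto simp: prime_filter_def\<close>)

text \<open>
  If \<open>Conj \<chi> (\<delta> i)\<close> entailed \<open>\<psi>\<close> for every \<open>i\<close>, then so would \<open>Conj \<chi> (Disj \<delta>)\<close>, by distributivity.
  Hence either \<open>\<chi>\<close> already excludes \<open>Disj \<delta>\<close> from every filter that omits \<open>\<psi>\<close>, or some disjunct can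
  be adjoined to \<open>\<chi>\<close>. The first alternative is phrased so that it persists when \<open>\<chi>\<close> is strengthened
  further, so it suffices to treat each disjunction once.
\<close>

lemma settle_formula:
  assumes \<chi>: "\<chi> \<in> formulas V" "\<not> derivable V T \<chi> \<psi>"
    and \<theta>: "\<theta> \<in> formulas V"
  shows "\<exists>\<chi>'. (\<chi>' \<in> formulas V \<and> \<not> derivable V T \<chi>' \<psi>) \<and> derivable V T \<chi>' \<chi> \<and>
    (\<forall>\<delta>. \<theta> = Disj \<delta> \<longrightarrow> derivable V T (Conj \<chi>' \<theta>) \<psi> \<or> (\<exists>i. derivable V T \<chi>' (\<delta> i)))"
proof (cases "\<exists>\<delta>. \<theta> = Disj \<delta> \<and> \<not> derivable V T (Conj \<chi> \<theta>) \<psi>")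
  case True
  then obtain \<delta> where \<delta>: "\<theta> = Disj \<delta>" "\<not> derivable V T (Conj \<chi> (Disj \<delta>)) \<psi>"
    by blast
  have \<delta>V: "\<delta> i \<in> formulas V" for i
    using \<theta> \<delta>(1) by (auto elim: formulas.cases)
  have "\<exists>i. \<not> derivable V T (Conj \<chi> (\<delta> i)) \<psi>"
  proof (rule ccontr)
    assume "\<nexists>i. \<not> derivable V T (Conj \<chi> (\<delta> i)) \<psi>"
    then have "derivable V T (Disj (\<lambda>i. Conj \<chi> (\<delta> i))) \<psi>"
      by (intro derivable.disj_left) auto
    then show False
      using derivable.cut[OF derivable.distrib] \<chi>(1) \<delta>V \<delta>(2) by blast
  qed
  then obtain i where "\<not> derivable V T (Conj \<chi> (\<delta> i)) \<psi>" ..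
  then show ?thesis
    using \<chi>(1) \<delta>V \<delta>(1)
    by (intro exI[of _ "Conj \<chi> (\<delta> i)"])
      (auto intro: formulas.Conj derivable.conj_left1 derivable.conj_left2)
next
  case False
  then show ?thesis
    using \<chi> by (auto intro: derivable.refl)
qed

lemma prime_filter_exists:
  assumes K: "countable K" "K \<subseteq> formulas V"
    and \<phi>: "\<phi> \<in> formulas V" and \<psi>: "\<psi> \<in> formulas V"
    and not_derivable: "\<not> derivable V T \<phi> \<psi>"
  obtains F where "prime_filter V T K F" and "\<phi> \<in> F" and "\<psi> \<notin> F"
proof -
  (* Adding Top makes K nonempty, so that it is the range of a sequence. *)
  have range_e: "range (from_nat_into (insert Top K)) = insert Top K"
    using K(1) by (intro range_from_nat_into) auto
  define e where "e = from_nat_into (insert Top K)"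
  have e_formulas: "e n \<in> formulas V" for n
    using range_e K(2) formulas.Top unfolding e_def by (metis insertE rangeI subsetD)
  have "\<exists>\<chi>. \<forall>n. (\<chi> n \<in> formulas V \<and> \<not> derivable V T (\<chi> n) \<psi> \<and> (n = 0 \<longrightarrow> \<chi> n = \<phi>)) \<and>
      (derivable V T (\<chi> (Suc n)) (\<chi> n) \<and>
       (\<forall>\<delta>. e n = Disj \<delta> \<longrightarrow> derivable V T (Conj (\<chi> (Suc n)) (e n)) \<psi> \<or>
          (\<exists>i. derivable V T (\<chi> (Suc n)) (\<delta> i))))"
    using \<phi> not_derivable settle_formula[OF _ _ e_formulas]
    by (intro dependent_nat_choice) auto
  then obtain \<chi> where
      \<chi>_formulas: "\<chi> n \<in> formulas V" and
      \<chi>_avoids: "\<not> derivable V T (\<chi> n) \<psi>" and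
      \<chi>_0: "\<chi> 0 = \<phi>" and
      \<chi>_step: "derivable V T (\<chi> (Suc n)) (\<chi> n)" and
      \<chi>_settles: "e n = Disj \<delta> \<Longrightarrow>
        derivable V T (Conj (\<chi> (Suc n)) (e n)) \<psi> \<or> (\<exists>i. derivable V T (\<chi> (Suc n)) (\<delta> i))"
    for n \<delta>
    by metis
  have \<chi>_mono: "derivable V T (\<chi> n) (\<chi> m)" if "m \<le> n" for m n
    using that
    by (induction rule: dec_induct)
      (auto intro: derivable.refl derivable.cut \<chi>_formulas \<chi>_step)

  define F where "F = {\<theta>. \<exists>n. derivable V T (\<chi> n) \<theta>}"
  have joint_stage: "\<exists>n. derivable V T (\<chi> n) \<theta> \<and> derivable V T (\<chi> n) \<theta>'"
    if "\<theta> \<in> F" "\<theta>' \<in> F" for \<theta> \<theta>'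
  proof -
    obtain m n where "derivable V T (\<chi> m) \<theta>" "derivable V T (\<chi> n) \<theta>'"
      using \<open>\<theta> \<in> F\<close> \<open>\<theta>' \<in> F\<close> unfolding F_def by blast
    then show ?thesis
      using derivable.cut \<chi>_mono max.cobounded1 max.cobounded2 by metis
  qed
  have up: "\<theta>' \<in> F" if "\<theta> \<in> F" "derivable V T \<theta> \<theta>'" for \<theta> \<theta>'
    using that derivable.cut unfolding F_def by blast
  have conj: "Conj \<theta> \<theta>' \<in> F" if "\<theta> \<in> F" "\<theta>' \<in> F" for \<theta> \<theta>'
    using joint_stage[OF that] derivable.conj_right unfolding F_def by blast
  have stage_in: "\<chi> n \<in> F" for n
    using derivable.refl \<chi>_formulas unfolding F_def by blast
  have \<psi>_notin: "\<psi> \<notin> F"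
    using \<chi>_avoids unfolding F_def by blast
  have prime: "\<exists>i. \<delta> i \<in> F" if "Disj \<delta> \<in> K" "Disj \<delta> \<in> F" for \<delta>
  proof -
    obtain n where "e n = Disj \<delta>"
      using range_e \<open>Disj \<delta> \<in> K\<close> unfolding e_def by (metis insertCI rangeE)
    moreover have "\<not> derivable V T (Conj (\<chi> (Suc n)) (Disj \<delta>)) \<psi>"
      using conj[OF stage_in \<open>Disj \<delta> \<in> F\<close>] up \<psi>_notin by blast
    ultimately show ?thesis
      using \<chi>_settles[of n \<delta>] unfolding F_def by auto
  qed
  have "Top \<in> F"
    using up[OF stage_in derivable.top] \<chi>_formulas by blast
  moreover have "Bot \<notin> F"
    using up derivable.bot \<psi> \<psi>_notin by blast
  ultimately have "prime_filter V T K F"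
    using up conj prime unfolding prime_filter_def by blast
  moreover have "\<phi> \<in> F"
    using stage_in[of 0] \<chi>_0 by simp
  ultimately show thesis
    using that \<psi>_notin by blast
qed

lemma subformulas_formulas: "\<phi> \<in> formulas V \<Longrightarrow> subformulas \<phi> \<subseteq> formulas V"
  by (induction rule: formulas.induct) (auto intro: formulas.intros)

lemma derivable_complete:
  assumes T: "countable T" "T \<subseteq> sequents V"
    and \<phi>: "\<phi> \<in> formulas V" and \<psi>: "\<psi> \<in> formulas V"
    and sub: "extent V T \<phi> \<subseteq> extent V T \<psi>"
  shows "derivable V T \<phi> \<psi>"
proof (rule ccontr)
  assume not_derivable: "\<not> derivable V T \<phi> \<psi>"
  define A where "A = {\<phi>, \<psi>} \<union> fst ` T \<union> snd ` T"
  define K where "K = (\<Union>\<theta>\<in>A. subformulas \<theta>)"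
  have A: "A \<subseteq> formulas V"
    using \<phi> \<psi> T(2) unfolding A_def sequents_def by auto
  have "countable K"
    unfolding K_def A_def using T(1) countable_subformulas by (intro countable_UN) auto
  moreover have "K \<subseteq> formulas V"
    using A subformulas_formulas unfolding K_def by blast
  ultimately obtain F where F: "prime_filter V T K F" "\<phi> \<in> F" "\<psi> \<notin> F"
    using prime_filter_exists[OF _ _ \<phi> \<psi> not_derivable] by metis
  define M where "M = restrict (\<lambda>p. Var p \<in> F) V"
  have truth: "M \<Turnstile> \<theta> \<longleftrightarrow> \<theta> \<in> F" if "\<theta> \<in> A" for \<theta>
    unfolding M_def using that A by (intro satisfies_iff_mem[OF F(1)]) (auto simp: K_def)
  have "M \<Turnstile> \<theta>" if "(\<sigma>, \<theta>) \<in> T" "M \<Turnstile> \<sigma>" for \<sigma> \<theta>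
  proof -
    have "\<sigma> \<in> A" "\<theta> \<in> A"
      using \<open>(\<sigma>, \<theta>) \<in> T\<close> unfolding A_def by force+
    then show ?thesis
      using truth \<open>M \<Turnstile> \<sigma>\<close> F(1) derivable.axiom[OF \<open>(\<sigma>, \<theta>) \<in> T\<close>] unfolding prime_filter_def by metis
  qed
  then have "M \<in> models V T"
    unfolding models_def M_def by auto
  moreover have "M \<Turnstile> \<phi>" "\<not> M \<Turnstile> \<psi>"
    using truth F(2,3) unfolding A_def by auto
  ultimately show False
    using sub unfolding extent_def by blast
qed

theorem theorem4:
  fixes V :: "'v set" and T :: "'v sequent set" and \<phi> \<psi> :: "'v form"
  assumes "countable V"
    and "countable_theory V T"
    and "\<phi> \<in> formulas V" and "\<psi> \<in> formulas V"
  shows "derivable V T \<phi> \<psi> \<longleftrightarrow> extent V T \<phi> \<subseteq> extent V T \<psi>"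
  using assms derivable_sound derivable_complete
  unfolding countable_theory_def extent_def by blast

end
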